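(* Consider the asynchronous market process described in the context, and assume the demand functions satisfy: (fixed spending) $\sum_ip_ix_i(p)=M$ for all $p$ (constant $M>0$); (WGS) for $j\ne i$, $x_j(p)$ is non-decreasing in $p_i$; (elasticity $E$) each $x_i$ is differentiable in $p_i$ with $\frac{x_i(p)}{p_i}\le-\frac{\partial x_i}{\partial p_i}(p)\le E\frac{x_i(p)}{p_i}$ for all $p$, where $E\ge 1$. Suppose $x_i(t)\le d\,w_i$ for all $i$ and all $t$, where $d\ge2$, and that $\alpha_1(d-1)\le1$ and $\lambda\alpha_1+\lambda\big(1+\frac{2Ed}{1-\lambda E}\big)\le1$ (with $\lambda E<1$). Then for all $t\ge0$, $\phi(t+1)\le\big(1-\frac{\lambda\alpha_1}{2}\big)\phi(t)$. Hence $\phi$ decreases from $\phi_I$ to at most $\phi_F$ within $O\big(\frac{1}{\lambda\alpha_1}\log\frac{\phi_I}{\phi_F}\big)$ days.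
   Context: Asynchronous market process: $n$ goods with daily supply rates $w_i>0$ and demand functions $x_i:(0,\infty)^n\to(0,\infty)$ (demands are instantaneous daily rates). Time $t\ge0$ is continuous (unit: one day). The price vector $p(t)$ is piecewise constant and right-continuous with finitely many changes in any bounded interval; write $x_i(t)=x_i(p(t))$. Each price $p_i$ changes only at its own update times; time $0$ is an update time for every good and consecutive update times of the same good are at most $1$ apart. $\tau_i(t)$ denotes the last update time of $p_i$ that is $\le t$, and $\bar x_i(t)=\frac1{t-\tau_i(t)}\int_{\tau_i(t)}^t x_i(s)\,ds$ if $t>\tau_i(t)$ (with $\bar x_i(t)=x_i(t)$ if $t=\tau_i(t)$). At an update time $t$ of good $i$, $p_i(t)=p_i(t^-)\big(1+\lambda\min\{1,\frac{\bar x_i(t^-)-w_i}{w_i}\}\big)$, where $\bar x_i(t^-)$ is the average demand over $[\tau_i(t^-),t]$; $\lambda>0$ is a fixed parameter. For reals $a,b,c$, $\mathrm{span}(a,b,c)=\max\{a,b,c\}-\min\{a,b,c\}$. The potential is $\phi=\sum_i\phi_i$ with $\phi_i(t)=p_i(t)\big[\mathrm{span}(x_i(t),\bar x_i(t),w_i)-\alpha_1\lambda|w_i-\bar x_i(t)|\,(t-\tau_i(t))\big]$, where $\alpha_1>0$ is a constant. *)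

theory Defs
  imports "HOL-Analysis.Analysis"
begin

text \<open>Goods are indexed by a finite type 'g. A price trajectory is
  P :: real \<Rightarrow> 'g \<Rightarrow> real (only t \<ge> 0 matters); U i is the set of update times
  of good i; x i p is the demand for good i at price vector p.\<close>

definition span3 :: "real \<Rightarrow> real \<Rightarrow> real \<Rightarrow> real" where
  "span3 a b c = max a (max b c) - min a (min b c)"

definition last_upd :: "('g \<Rightarrow> real set) \<Rightarrow> 'g \<Rightarrow> real \<Rightarrow> real" where
  "last_upd U i t = Max (U i \<inter> {0..t})"

definition prev_upd :: "('g \<Rightarrow> real set) \<Rightarrow> 'g \<Rightarrow> real \<Rightarrow> real" where
  "prev_upd U i t = Max (U i \<inter> {0..<t})"

definition avg_dem ::
  "('g \<Rightarrow> ('g \<Rightarrow> real) \<Rightarrow> real) \<Rightarrow> (real \<Rightarrow> 'g \<Rightarrow> real) \<Rightarrow> 'g \<Rightarrow> real \<Rightarrow> real \<Rightarrow> real" where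
  "avg_dem x P i a t = integral {a..t} (\<lambda>s. x i (P s)) / (t - a)"

definition xbar ::
  "('g \<Rightarrow> ('g \<Rightarrow> real) \<Rightarrow> real) \<Rightarrow> (real \<Rightarrow> 'g \<Rightarrow> real) \<Rightarrow> ('g \<Rightarrow> real set) \<Rightarrow> 'g \<Rightarrow> real \<Rightarrow> real" where
  "xbar x P U i t =
     (if t = last_upd U i t then x i (P t) else avg_dem x P i (last_upd U i t) t)"

definition phi_i ::
  "real \<Rightarrow> real \<Rightarrow> ('g \<Rightarrow> real) \<Rightarrow> ('g \<Rightarrow> ('g \<Rightarrow> real) \<Rightarrow> real) \<Rightarrow> (real \<Rightarrow> 'g \<Rightarrow> real)
     \<Rightarrow> ('g \<Rightarrow> real set) \<Rightarrow> 'g \<Rightarrow> real \<Rightarrow> real" where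
  "phi_i alpha1 lam w x P U i t =
     P t i * (span3 (x i (P t)) (xbar x P U i t) (w i)
              - alpha1 * lam * \<bar>w i - xbar x P U i t\<bar> * (t - last_upd U i t))"

definition phi ::
  "real \<Rightarrow> real \<Rightarrow> ('g::finite \<Rightarrow> real) \<Rightarrow> ('g \<Rightarrow> ('g \<Rightarrow> real) \<Rightarrow> real) \<Rightarrow> (real \<Rightarrow> 'g \<Rightarrow> real)
     \<Rightarrow> ('g \<Rightarrow> real set) \<Rightarrow> real \<Rightarrow> real" where
  "phi alpha1 lam w x P U t = (\<Sum>i\<in>UNIV. phi_i alpha1 lam w x P U i t)"

end

theory Submission
  imports Defs
begin

text \<open>While prices rest, each \<open>\<phi>\<^sub>i\<close> decays at relative rate \<open>\<lambda> \<alpha>\<^sub>1\<close>: either the span itself shrinks because the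
  average drifts towards the current demand, or the correction term grows fast enough.
  At an update \<open>\<phi>\<close> does not increase: by fixed spending and weak gross substitutes, the terms of the
  other goods grow by at most the spending moved by the updated good, and the elasticity bounds show that the
  drop in its own term pays for it. Simultaneous updates are carried out one good at a time. Over a day this gives the
  factor \<open>exp (- \<lambda> \<alpha>\<^sub>1) \<le> 1 - \<lambda> \<alpha>\<^sub>1 / 2\<close>.\<close>

text \<open>Induction on the number of points of \<open>V\<close> strictly inside the interval:
  cutting at one of them leaves fewer inside each half. It carries facts about event-free stretches
  to all intervals; the endpoints of a base interval may themselves lie in \<open>V\<close>.\<close>

lemma interval_chain_induct:
  fixes V :: "real set" and Q :: "real \<Rightarrow> real \<Rightarrow> bool"
  assumes fin: "finite (V \<inter> {a<..<b})"
    and base: "\<And>a b. 0 \<le> a \<Longrightarrow> a < b \<Longrightarrow> V \<inter> {a<..<b} = {} \<Longrightarrow> Q a b"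
    and trans: "\<And>a b c. 0 \<le> a \<Longrightarrow> a < b \<Longrightarrow> b < c \<Longrightarrow> Q a b \<Longrightarrow> Q b c \<Longrightarrow> Q a c"
    and "0 \<le> a" "a < b"
  shows "Q a b"
  using fin \<open>0 \<le> a\<close> \<open>a < b\<close>
proof (induction "card (V \<inter> {a<..<b})" arbitrary: a b rule: less_induct)
  case less
  show ?case
  proof (cases "V \<inter> {a<..<b} = {}")
    case True
    then show ?thesis using base less.prems by blast
  next
    case False
    then obtain u where u: "u \<in> V" "a < u" "u < b" by auto
    have l: "V \<inter> {a<..<u} \<subset> V \<inter> {a<..<b}" and r: "V \<inter> {u<..<b} \<subset> V \<inter> {a<..<b}"
      using u by auto
    have "Q a u"
      using less.hyps[OF psubset_card_mono[OF less.prems(1) l]] l less.prems u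
      by (meson finite_subset psubset_imp_subset)
    moreover have "Q u b"
      using less.hyps[OF psubset_card_mono[OF less.prems(1) r]] r less.prems u
      by (meson finite_subset psubset_imp_subset less_imp_le order_trans)
    ultimately show ?thesis using trans u less.prems by blast
  qed
qed

section \<open>The span of three reals and its decay while prices rest\<close>

lemma span3_ge: "\<bar>a - b\<bar> \<le> span3 a b c" "\<bar>a - c\<bar> \<le> span3 a b c" "\<bar>b - c\<bar> \<le> span3 a b c"
  by (auto simp: span3_def)

text \<open>Bounds the growth of the term of a good whose own price stays put while another price
  moves its demand.\<close>

lemma span3_lipschitz: "span3 a b c \<le> span3 a' b c + \<bar>a - a'\<bar>"
  by (auto simp: span3_def)

lemma span3_same: "span3 a a c = \<bar>a - c\<bar>"
  by (auto simp: span3_def)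

lemma span3_uminus: "span3 (- a) (- b) (- c) = span3 a b c"
  by (auto simp: span3_def)

lemma span3_shift: "span3 (a - r) (b - r) (c - r) = span3 a b c"
  by (auto simp: span3_def)

text \<open>While the prices rest, the average moves from \<open>Y\<close> to \<open>(a * Y + h * X) / (a + h)\<close>; here \<open>X\<close> and
  \<open>Y\<close> are the excess demand and its average, so that the supply sits at \<open>0\<close>.\<close>

lemma flow_decrease_nonneg:
  fixes X Y a h c :: real
  assumes X: "0 \<le> X" and a: "0 \<le> a" and h: "0 < h" and ah: "a + h \<le> 1" and c: "0 \<le> c" "c \<le> 1/2"
  shows "span3 X ((a * Y + h * X) / (a + h)) 0 - c * \<bar>a * Y + h * X\<bar>
         \<le> (1 - c * h) * (span3 X Y 0 - c * a * \<bar>Y\<bar>)"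
proof -
  define Z where "Z = (a * Y + h * X) / (a + h)"
  have Z: "(a + h) * Z = a * Y + h * X" using a h by (simp add: Z_def)
  \<comment> \<open>The second-order term left over when the product on the right is expanded; it
    has a favourable sign in every case.\<close>
  have c2: "0 \<le> c * c * (h * a)" using a h by simp
  have drift: "Z - Y = h * (X - Y) / (a + h)" "X - Z = a * (X - Y) / (a + h)"
    using a h by (auto simp: Z_def field_simps)
  have below: "Z \<le> X" if "Y \<le> X"
    using drift(2) that a h by (smt (verit) divide_nonneg_nonneg mult_nonneg_nonneg)
  have above: "X \<le> Z" "Z \<le> Y" if "X \<le> Y"
    using drift that a h by (smt (verit) divide_nonpos_pos mult_nonneg_nonpos)+
  \<comment> \<open>The cases fix the order of \<open>0\<close>, \<open>X\<close>, \<open>Y\<close>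
    and \<open>Z\<close>: average between supply and demand, average beyond demand, and average
    below supply, where it either reaches the supply or stays short of it.\<close>
  consider "0 \<le> Y" "Y \<le> X" | "X < Y" | "Y < 0" "0 \<le> Z" | "Y < 0" "Z < 0" by linarith
  then show ?thesis
  proof cases
    case 1
    have "Z \<le> X" using below 1 by simp
    moreover have "0 \<le> Z" "0 \<le> a * Y + h * X" using 1 a h by (auto simp: Z_def)
    ultimately have "span3 X Z 0 = X" "\<bar>a * Y + h * X\<bar> = a * Y + h * X" "span3 X Y 0 = X" "\<bar>Y\<bar> = Y"
      using 1 by (auto simp: span3_def)
    moreover have "0 \<le> c * c * (h * a) * Y" using c2 1 by simp
    ultimately show ?thesis unfolding Z_def[symmetric] by (simp add: algebra_simps)
  next
    case 2
    then have Y: "0 < Y" using X by simp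
    have "X \<le> Z" using above 2 by simp
    moreover have "Z \<le> Y" using above 2 by simp
    moreover have "0 \<le> a * Y + h * X" using X Y a h by simp
    ultimately have e: "span3 X Z 0 = Z" "\<bar>a * Y + h * X\<bar> = a * Y + h * X" "span3 X Y 0 = Y" "\<bar>Y\<bar> = Y"
      using X 2 by (auto simp: span3_def)
    \<comment> \<open>The average closes the fraction \<open>h / (a + h)\<close> of its gap to the
      demand, which is at least \<open>h\<close> because the period is at most a day.\<close>
    have "h * (Y - X) \<le> h * (Y - X) / (a + h)"
      using 2 a h ah by (simp add: le_divide_eq mult_left_le)
    then have "h * (Y - X) \<le> Y - Z" using drift(1) by (simp add: algebra_simps minus_divide_left)
    moreover have "0 \<le> (1 - c) * (h * (Y - X))" using c 2 h by simp
    moreover have "0 \<le> c * c * (h * a) * Y" using c2 Y by simp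
    ultimately show ?thesis unfolding Z_def[symmetric] e by (simp add: algebra_simps)
  next
    case 3
    have "Z \<le> X" using below X 3 by simp
    moreover have "0 \<le> a * Y + h * X" using Z 3 a h by (metis add_nonneg_nonneg less_imp_le mult_nonneg_nonneg)
    ultimately have e: "span3 X Z 0 = X" "\<bar>a * Y + h * X\<bar> = a * Y + h * X" "span3 X Y 0 = X - Y" "\<bar>Y\<bar> = - Y"
      using X 3 by (auto simp: span3_def)
    \<comment> \<open>When the average crosses the supply, the span drops by all of
      \<open>- Y\<close>; this pays for the correction because \<open>2 * a + h\<close> is at most 2
      and \<open>c\<close> at most 1/2.\<close>
    have "c * (2 * a + h) \<le> 1/2 * 2" using c a h ah by (intro mult_mono) auto
    then have "0 \<le> (1 - c * (2 * a + h) + c * c * (h * a)) * (- Y)" using c2 3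
      by (intro mult_nonneg_nonneg) auto
    then show ?thesis unfolding Z_def[symmetric] e by (simp add: algebra_simps)
  next
    case 4
    have "a * Y + h * X < 0" using Z 4 a h by (metis add_nonneg_pos mult_pos_neg)
    then have e: "span3 X Z 0 = X - Z" "\<bar>a * Y + h * X\<bar> = - (a * Y + h * X)" "span3 X Y 0 = X - Y" "\<bar>Y\<bar> = - Y"
      using X 4 by (auto simp: span3_def)
    have "h * (X - Y) \<le> h * (X - Y) / (a + h)"
      using X 4 a h ah by (simp add: le_divide_eq mult_left_le)
    then have "h * (X - Y) \<le> Z - Y" using drift(1) by simp
    \<comment> \<open>Here the correction shrinks by \<open>c * h * X\<close> while the required
      decay costs as much again, so \<open>c \<le> 1/2\<close> is exactly what keeps the coefficient
      of \<open>X\<close> nonnegative.\<close>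
    moreover have "0 \<le> h * X * (1 - 2 * c)" using c X h by simp
    moreover have "0 \<le> h * (- Y) * (1 - c)" using c h 4 by (intro mult_nonneg_nonneg; simp)
    moreover have "0 \<le> c * c * (h * a) * (- Y)" using c2 4 by (simp add: mult_nonneg_nonpos)
    ultimately show ?thesis unfolding Z_def[symmetric] e by (simp add: algebra_simps)
  qed
qed

text \<open>Subtracting \<open>w\<close> puts the supply at 0, and a demand below supply is
  reflected to one above it by a change of sign; neither alters spans or distances.\<close>

lemma flow_decrease:
  fixes X m w a h c :: real
  assumes a: "0 \<le> a" and h: "0 < h" and ah: "a + h \<le> 1" and c: "0 \<le> c" "c \<le> 1/2"
  defines "m' \<equiv> (a * m + h * X) / (a + h)"
  shows "span3 X m' w - c * \<bar>w - m'\<bar> * (a + h)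
         \<le> (1 - c * h) * (span3 X m w - c * \<bar>w - m\<bar> * a)"
proof -
  have shift: "m' - w = (a * (m - w) + h * (X - w)) / (a + h)"
    using a h by (simp add: m'_def field_simps)
  then have abs: "\<bar>w - m'\<bar> * (a + h) = \<bar>a * (m - w) + h * (X - w)\<bar>"
    using a h by (simp add: abs_minus_commute[of w])
  have "span3 (X - w) (m' - w) 0 - c * \<bar>a * (m - w) + h * (X - w)\<bar>
        \<le> (1 - c * h) * (span3 (X - w) (m - w) 0 - c * a * \<bar>m - w\<bar>)"
  proof (cases "w \<le> X")
    case True
    then show ?thesis using flow_decrease_nonneg[of "X - w" a h c "m - w"] assms shift by simp
  next
    case False
    have "(a * (w - m) + h * (w - X)) / (a + h) = - (m' - w)"
      "\<bar>a * (w - m) + h * (w - X)\<bar> = \<bar>a * (m - w) + h * (X - w)\<bar>"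
      unfolding shift minus_divide_left by (simp_all add: algebra_simps abs_if)
    then show ?thesis
      using flow_decrease_nonneg[of "w - X" a h c "w - m"] assms False
        span3_uminus[of "X - w" "m' - w" 0] span3_uminus[of "X - w" "m - w" 0]
      by (simp add: abs_minus_commute)
  qed
  then show ?thesis
    using span3_shift[of X w m' w] span3_shift[of X w m w] abs
    by (simp add: abs_minus_commute algebra_simps)
qed

section \<open>Numerical inequalities for a single price change\<close>

lemma parameter_bounds:
  fixes lam alpha E d :: real
  assumes lam: "0 < lam" and alpha: "0 < alpha" and E: "1 \<le> E" and d: "2 \<le> d"
    and alpha_d: "alpha * (d - 1) \<le> 1" and lamE: "lam * E < 1"
    and cond: "lam * alpha + lam * (1 + 2 * E * d / (1 - lam * E)) \<le> 1"
  shows "alpha \<le> 1" "lam < 1" "lam * alpha \<le> 1/2" "lam * (1 + 2 * E) \<le> 1"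
    "2 * E / (1 - lam * E) \<le> 2 * E * d / (1 - lam * E)"
proof -
  have "alpha * 1 \<le> alpha * (d - 1)" using alpha d by (intro mult_left_mono) auto
  then show a: "alpha \<le> 1" using alpha_d by simp
  have g: "0 < 1 - lam * E" "1 - lam * E \<le> 1" using lamE lam E by auto
  show K: "2 * E / (1 - lam * E) \<le> 2 * E * d / (1 - lam * E)"
    using g E d by (intro divide_right_mono) auto
  have "2 * E \<le> 2 * E / (1 - lam * E)" using g E by (simp add: le_divide_eq mult_left_le)
  then have "lam * (1 + 2 * E) \<le> lam * (1 + 2 * E * d / (1 - lam * E))"
    using K lam by (intro mult_left_mono) auto
  moreover have "0 < lam * alpha" using lam alpha by simp
  ultimately show l: "lam * (1 + 2 * E) \<le> 1" using cond by simp
  have "lam * 3 \<le> lam * (1 + 2 * E)" using lam E by (intro mult_left_mono) auto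
  then have l3: "lam * 3 \<le> 1" using l by simp
  then show "lam < 1" by simp
  have "lam * alpha \<le> lam * 1" using lam a by (intro mult_left_mono) auto
  then show "lam * alpha \<le> 1/2" using l3 by simp
qed

text \<open>In the next two lemmas \<open>X\<close> and \<open>X'\<close> are the demands before and after the price is multiplied by
  \<open>1 + r\<close> resp. \<open>1 - r\<close>. The first two terms on the left are, per unit of the old price, the spending that
  moves between this good and the others; it bounds what the others can add to the potential.\<close>

lemma price_rise_pays:
  fixes lam alpha E d X X' m w a r :: real
  assumes lam: "0 < lam" and alpha: "0 < alpha" and E: "1 \<le> E" and d: "2 \<le> d"
    and alpha_d: "alpha * (d - 1) \<le> 1" and lamE: "lam * E < 1"
    and cond: "lam * alpha + lam * (1 + 2 * E * d / (1 - lam * E)) \<le> 1"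
    and w: "0 < w" and X: "0 < X" "0 < X'" and m: "w \<le> m" "m \<le> d * w" and a: "0 \<le> a" "a \<le> 1"
    and r: "r = lam * min 1 ((m - w) / w)"
    and elastic: "(1 + r) * X' \<le> X" "X * (1 - E * r) \<le> X'"
  shows "X - (1 + r) * X' + (1 + r) * \<bar>X' - w\<bar> \<le> span3 X m w - alpha * lam * \<bar>w - m\<bar> * a"
proof -
  note pb = parameter_bounds[OF lam alpha E d alpha_d lamE cond]
  define D where "D = m - w"
  have D: "0 \<le> D" "\<bar>w - m\<bar> = D" using m by (auto simp: D_def)
  \<comment> \<open>This is the purpose of \<open>alpha * (d - 1) \<le> 1\<close>: even when the
    relative excess is capped at 1, the price step \<open>r * w\<close> still covers the correction
    term.\<close>
  have aD: "alpha * D \<le> w"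
  proof -
    have "alpha * D \<le> alpha * ((d - 1) * w)"
      using alpha m by (intro mult_left_mono) (auto simp: D_def algebra_simps)
    also have "\<dots> \<le> 1 * w" using alpha_d w by (subst mult.assoc[symmetric], intro mult_right_mono) auto
    finally show ?thesis by simp
  qed
  have r0: "0 \<le> r" using lam m w by (simp add: r)
  have "min 1 ((m - w) / w) \<le> 1" by simp
  then have r1: "r \<le> lam" using lam unfolding r by (simp add: mult_left_le)
  have rw: "r * w = lam * min w D" using w by (simp add: r D_def min_def field_simps)
  then have rw_le: "r * w \<le> lam * D" using lam by simp
  have rw_ge: "alpha * lam * D \<le> r * w"
  proof -
    have "alpha * D \<le> 1 * D" using pb(1) D by (intro mult_right_mono) auto
    then have "lam * (alpha * D) \<le> lam * min w D" using aD lam by (intro mult_left_mono) auto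
    then show ?thesis using rw by (simp add: algebra_simps)
  qed
  have pen: "alpha * lam * \<bar>w - m\<bar> * a \<le> alpha * lam * D"
    using a alpha lam D by (simp add: mult_left_le)
  show ?thesis
  \<comment> \<open>If demand does not fall below supply, the left side collapses to
    \<open>X - w - r * w\<close>. Otherwise the update overshoots, but then elasticity forces
    \<open>X\<close> to be at most \<open>w / (1 - lam * E)\<close>, so the spending moved is small
    against \<open>D\<close>.\<close>
  proof (cases "w \<le> X'")
    case True
    then show ?thesis
      using span3_ge(2)[of X w m] pen rw_ge by (simp add: algebra_simps)
  next
    case False
    have "X * (1 - lam * E) \<le> X * (1 - E * r)"
      using X r1 E by (intro mult_left_mono) (auto simp: mult.commute)
    then have "X * (1 - lam * E) \<le> w" using elastic False by linarith
    then have "X \<le> w / (1 - lam * E)" using lamE by (simp add: le_divide_eq)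
    then have "2 * E * r * X \<le> 2 * E * r * (w / (1 - lam * E))"
      using r0 E by (intro mult_left_mono) auto
    also have "\<dots> = 2 * E / (1 - lam * E) * (r * w)" by simp
    also have "\<dots> \<le> 2 * E / (1 - lam * E) * (lam * D)"
      using rw_le E lamE by (intro mult_left_mono) auto
    also have "\<dots> \<le> 2 * E * d / (1 - lam * E) * (lam * D)"
      using pb(5) lam D by (intro mult_right_mono) auto
    finally have K: "2 * E * r * X \<le> 2 * E * d / (1 - lam * E) * (lam * D)" .
    have "(lam * alpha + lam * (1 + 2 * E * d / (1 - lam * E))) * D \<le> 1 * D"
      using cond D by (intro mult_right_mono) auto
    then have "lam * D + 2 * E * d / (1 - lam * E) * (lam * D) \<le> D - alpha * lam * D"
      by (simp add: algebra_simps)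
    moreover have "X' \<le> (1 + r) * X'" using r0 X by simp
    moreover have "X - (1 + r) * X' + (1 + r) * \<bar>X' - w\<bar> = X + w + r * w - 2 * ((1 + r) * X')"
      using False by (simp add: algebra_simps)
    ultimately have "X - (1 + r) * X' + (1 + r) * \<bar>X' - w\<bar> \<le> w - X + D - alpha * lam * D"
      using K rw_le elastic(2) by (simp add: algebra_simps)
    then show ?thesis
      using pen span3_ge(1)[of X m w] span3_ge(3)[of m w X] D by (auto simp: D_def)
  qed
qed

lemma price_cut_pays:
  fixes lam alpha E d X X' m w a r :: real
  assumes lam: "0 < lam" and alpha: "0 < alpha" and E: "1 \<le> E" and d: "2 \<le> d"
    and alpha_d: "alpha * (d - 1) \<le> 1" and lamE: "lam * E < 1"
    and cond: "lam * alpha + lam * (1 + 2 * E * d / (1 - lam * E)) \<le> 1"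
    and w: "0 < w" and X: "0 < X" "X \<le> d * w" and m: "0 \<le> m" "m \<le> w" and a: "0 \<le> a" "a \<le> 1"
    and r: "r = lam * ((w - m) / w)"
    and elastic: "X \<le> (1 - r) * X'" "(1 - r) * X' * (1 - E * r) \<le> X"
  shows "(1 - r) * X' - X + (1 - r) * \<bar>X' - w\<bar> \<le> span3 X m w - alpha * lam * \<bar>w - m\<bar> * a"
proof -
  note pb = parameter_bounds[OF lam alpha E d alpha_d lamE cond]
  define D where "D = w - m"
  define Y where "Y = (1 - r) * X'"
  have D: "0 \<le> D" "\<bar>w - m\<bar> = D" using m by (auto simp: D_def)
  have r0: "0 \<le> r" using lam m w by (simp add: r)
  have "(w - m) / w \<le> 1" using m w by simp
  then have r1: "r \<le> lam" using mult_left_mono[of "(w - m) / w" 1 lam] lam unfolding r by simp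
  have rw: "r * w = lam * D" using w by (simp add: r D_def)
  have alam: "alpha * lam * D \<le> lam * D"
    using pb(1) lam D by (simp add: mult_right_le_one_le mult_left_le_one_le mult.assoc alpha less_imp_le)
  have pen: "alpha * lam * \<bar>w - m\<bar> * a \<le> alpha * lam * D"
    using a alpha lam D by (simp add: mult_left_le)
  show ?thesis
  \<comment> \<open>Without overshoot the left side is \<open>w - X - r * w\<close>. With overshoot
    twice the spending gain \<open>Y - X\<close> has to be paid for out of \<open>D\<close>.\<close>
  proof (cases "X' \<le> w")
    case True
    then show ?thesis
      using span3_ge(2)[of X w m] pen rw alam by (simp add: algebra_simps)
  next
    case False
    have Er: "E * r \<le> lam * E" using r1 E by (simp add: mult.commute)
    have "Y * (1 - lam * E) \<le> Y * (1 - E * r)"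
      using Er elastic(1) X by (intro mult_left_mono) (auto simp: Y_def)
    then have "Y \<le> X / (1 - lam * E)" using elastic(2) lamE by (simp add: Y_def le_divide_eq)
    then have "E * r * Y \<le> E * r * (X / (1 - lam * E))"
      using r0 E by (intro mult_left_mono) auto
    moreover have "Y - X \<le> E * r * Y" using elastic(2) by (simp add: Y_def algebra_simps)
    ultimately have "2 * (Y - X) \<le> 2 * E / (1 - lam * E) * r * X" by simp
    \<comment> \<open>An overshooting cut does not limit \<open>X\<close> by a multiple of
      \<open>w\<close> as an overshooting rise does, so the demand bound enters; this is the source
      of the factor \<open>d\<close> in the parameter condition.\<close>
    also have "\<dots> \<le> 2 * E / (1 - lam * E) * r * (d * w)"
      using X r0 E lamE by (intro mult_left_mono) auto
    also have "\<dots> = 2 * E * d / (1 - lam * E) * (r * w)" by simp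
    finally have K: "2 * (Y - X) \<le> 2 * E * d / (1 - lam * E) * (lam * D)" unfolding rw .
    have "(lam * alpha + lam * (1 + 2 * E * d / (1 - lam * E))) * D \<le> 1 * D"
      using cond D by (intro mult_right_mono) auto
    then have "lam * D + 2 * E * d / (1 - lam * E) * (lam * D) \<le> D - alpha * lam * D"
      by (simp add: algebra_simps)
    moreover have "Y - X + (1 - r) * \<bar>X' - w\<bar> = 2 * Y - X - w + r * w"
      using False by (simp add: Y_def algebra_simps)
    ultimately have "Y - X + (1 - r) * \<bar>X' - w\<bar> \<le> X - w + D - alpha * lam * D"
      using K rw by simp
    then show ?thesis
      using pen span3_ge(1)[of X m w] D by (auto simp: D_def Y_def)
  qed
qed

section \<open>Response of demand to a change of one price\<close>

locale elastic_market =
  fixes w :: "'g::finite \<Rightarrow> real"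
    and x :: "'g \<Rightarrow> ('g \<Rightarrow> real) \<Rightarrow> real"
    and lam alpha M E d :: real
  assumes w_pos: "w i > 0"
    and lam_pos: "lam > 0" and alpha_pos: "alpha > 0"
    and demand_pos: "(\<And>j. p j > 0) \<Longrightarrow> x i p > 0"
    and spending: "(\<And>j. p j > 0) \<Longrightarrow> (\<Sum>i\<in>UNIV. p i * x i p) = M"
    and WGS: "j \<noteq> i \<Longrightarrow> (\<And>k. p k > 0) \<Longrightarrow> 0 < a \<Longrightarrow> a \<le> b \<Longrightarrow> x j (p(i := a)) \<le> x j (p(i := b))"
    and E_ge: "E \<ge> 1"
    and elasticity: "(\<And>k. p k > 0) \<Longrightarrow>
          \<exists>D. ((\<lambda>q. x i (p(i := q))) has_real_derivative D) (at (p i))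
              \<and> x i p / p i \<le> - D \<and> - D \<le> E * (x i p / p i)"
    and d_ge: "d \<ge> 2"
    and alpha_d: "alpha * (d - 1) \<le> 1"
    and lamE: "lam * E < 1"
    and lam_cond: "lam * alpha + lam * (1 + 2 * E * d / (1 - lam * E)) \<le> 1"
begin

lemmas bounds = parameter_bounds[OF lam_pos alpha_pos E_ge d_ge alpha_d lamE lam_cond]
lemmas rise_pays = price_rise_pays[OF lam_pos alpha_pos E_ge d_ge alpha_d lamE lam_cond]
lemmas cut_pays = price_cut_pays[OF lam_pos alpha_pos E_ge d_ge alpha_d lamE lam_cond]

text \<open>The lower elasticity bound makes both \<open>g y\<close> and \<open>y * g y\<close>
  non-increasing, by the sign of their derivatives. The upper bound limits the loss of demand
  through the mean value theorem.\<close>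

lemma own_price_response:
  fixes i :: 'g
  assumes q: "\<And>k. q k > 0" and ab: "0 < a" "a \<le> b"
  defines "g \<equiv> \<lambda>y. x i (q(i := y))"
  shows "g b \<le> g a" "b * g b \<le> a * g a" "(a - E * (b - a)) * g a \<le> a * g b"
proof -
  have g_pos: "g y > 0" if "y > 0" for y
    unfolding g_def using q that by (intro demand_pos) auto
  have "\<exists>D. y > 0 \<longrightarrow> (g has_real_derivative D) (at y) \<and> g y / y \<le> - D \<and> - D \<le> E * (g y / y)" for y
    using elasticity[of "q(i := y)" i] q unfolding g_def by auto
  then obtain g' where g': "\<And>y. y > 0 \<Longrightarrow> (g has_real_derivative g' y) (at y)"
    "\<And>y. y > 0 \<Longrightarrow> g y / y \<le> - g' y" "\<And>y. y > 0 \<Longrightarrow> - g' y \<le> E * (g y / y)"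
    by metis
  have dec: "g v \<le> g u" if "0 < u" "u \<le> v" for u v
  proof (rule DERIV_nonpos_imp_nonincreasing[OF \<open>u \<le> v\<close>])
    fix y assume "u \<le> y" "y \<le> v"
    then have "y > 0" using that by simp
    then show "\<exists>D. (g has_real_derivative D) (at y) \<and> D \<le> 0"
      using g'(1,2)[of y] g_pos[of y] by (smt (verit) divide_pos_pos)
  qed
  then show "g b \<le> g a" using ab .
  show "b * g b \<le> a * g a"
  proof (rule DERIV_nonpos_imp_nonincreasing[OF \<open>a \<le> b\<close>])
    fix y assume "a \<le> y" "y \<le> b"
    then have y: "y > 0" using ab by simp
    have "((\<lambda>y. y * g y) has_real_derivative (g y + g' y * y)) (at y)"
      by (rule derivative_eq_intros g'(1)[OF y] refl | simp)+
    moreover have "g y + g' y * y \<le> 0" using g'(2)[OF y] y by (simp add: divide_le_eq)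
    ultimately show "\<exists>D. ((\<lambda>y. y * g y) has_real_derivative D) (at y) \<and> D \<le> 0" by blast
  qed
  show "(a - E * (b - a)) * g a \<le> a * g b"
  proof (cases "a = b")
    case False
    then have "a < b" using ab by simp
    then obtain z where z: "a < z" "z < b" "g b - g a = (b - a) * g' z"
      using MVT2[of a b g g'] g'(1) ab by force
    \<comment> \<open>Since \<open>g\<close> decreases and \<open>z > a\<close>, the elasticity
      bound at the unknown mean value point can be replaced by its value at
      \<open>a\<close>.\<close>
    have "g z / z \<le> g a / a"
      using dec[of a z] z ab g_pos[of z] by (intro frac_le) auto
    then have "- g' z \<le> E * (g a / a)"
      using g'(3)[of z] E_ge z ab mult_left_mono[of "g z / z" "g a / a" E] by force
    then have "(b - a) * (- g' z) \<le> (b - a) * (E * (g a / a))"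
      using ab by (intro mult_left_mono) auto
    then have "g a - g b \<le> (b - a) * (E * (g a / a))" using z(3) by simp
    then have "a * (g a - g b) \<le> a * ((b - a) * (E * (g a / a)))"
      using ab by (intro mult_left_mono) auto
    moreover have "a * ((b - a) * (E * (g a / a))) = (b - a) * (E * g a)" using ab by simp
    ultimately show ?thesis by (simp add: algebra_simps)
  qed simp
qed

section \<open>Spending flows and the potential across updates\<close>

text \<open>By gross substitutes all other demands move in the same direction, so the absolute
  values add up to the net change, and fixed spending equates that with the change of spending on
  good \<open>i\<close>.\<close>

lemma spending_shift:
  assumes q: "\<And>k. q k > 0" and r: "r > 0"
  shows "(\<Sum>j\<in>-{i}. q j * \<bar>x j (q(i := r)) - x j q\<bar>) = \<bar>q i * x i q - r * x i (q(i := r))\<bar>"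
proof -
  let ?q = "q(i := r)"
  have "(\<Sum>j\<in>UNIV. q j * x j q) = (\<Sum>j\<in>UNIV. ?q j * x j ?q)"
    using spending[of q] spending[of ?q] q r by auto
  moreover have "(\<Sum>j\<in>UNIV. f j) = f i + (\<Sum>j\<in>-{i}. f j)" for f :: "'g \<Rightarrow> real"
    using sum.remove[of UNIV i f] by (simp add: Compl_eq_Diff_UNIV)
  ultimately have "q i * x i q + (\<Sum>j\<in>-{i}. q j * x j q)
      = r * x i ?q + (\<Sum>j\<in>-{i}. ?q j * x j ?q)"
    by simp
  moreover have "(\<Sum>j\<in>-{i}. ?q j * x j ?q) = (\<Sum>j\<in>-{i}. q j * x j ?q)"
    by (rule sum.cong) auto
  ultimately have net: "(\<Sum>j\<in>-{i}. q j * (x j ?q - x j q)) = q i * x i q - r * x i ?q"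
    by (simp add: right_diff_distrib sum_subtractf)
  have mono: "(q i \<le> r \<longrightarrow> x j q \<le> x j ?q) \<and> (r \<le> q i \<longrightarrow> x j ?q \<le> x j q)" if "j \<noteq> i" for j
    using WGS[of j i q "q i" r] WGS[of j i q r "q i"] that q r by auto
  show ?thesis
  proof (cases "q i \<le> r")
    case True
    have "(\<Sum>j\<in>-{i}. q j * \<bar>x j ?q - x j q\<bar>) = (\<Sum>j\<in>-{i}. q j * (x j ?q - x j q))"
      using mono True by (intro sum.cong) auto
    moreover have "0 \<le> (\<Sum>j\<in>-{i}. q j * (x j ?q - x j q))"
      using mono True q by (intro sum_nonneg mult_nonneg_nonneg) (auto intro: less_imp_le)
    ultimately show ?thesis using net by simp
  next
    case False
    have "(\<Sum>j\<in>-{i}. q j * \<bar>x j ?q - x j q\<bar>) = (\<Sum>j\<in>-{i}. - (q j * (x j ?q - x j q)))"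
    proof (rule sum.cong)
      fix j assume "j \<in> -{i}"
      then have "x j ?q - x j q \<le> 0" using mono[of j] False by simp
      then show "q j * \<bar>x j ?q - x j q\<bar> = - (q j * (x j ?q - x j q))"
        by (simp add: right_diff_distrib)
    qed simp
    moreover have "0 \<le> (\<Sum>j\<in>-{i}. q j * \<bar>x j ?q - x j q\<bar>)"
      using q by (intro sum_nonneg mult_nonneg_nonneg) (auto intro: less_imp_le)
    ultimately show ?thesis using net by (simp add: sum_negf)
  qed
qed

text \<open>The potential in the midst of a simultaneous update: the goods in \<open>A\<close> already have their new
  price (and average demand reset to the current demand); every other good \<open>j\<close> still carries its average
  demand \<open>m j\<close> taken over a period of length \<open>a j\<close>.\<close>

definition jump_pot :: "'g set \<Rightarrow> ('g \<Rightarrow> real) \<Rightarrow> ('g \<Rightarrow> real) \<Rightarrow> ('g \<Rightarrow> real) \<Rightarrow> real" where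
  "jump_pot A m a q = (\<Sum>j\<in>UNIV. q j * (if j \<in> A then \<bar>x j q - w j\<bar>
      else span3 (x j q) (m j) (w j) - alpha * lam * \<bar>w j - m j\<bar> * a j))"

text \<open>Each other term grows by at most its price times the change of its demand; the sum of
  these is the spending shift, which \<open>pays\<close> charges to good \<open>i\<close>.\<close>

lemma jump_pot_step:
  assumes q: "\<And>k. q k > 0" and r: "r > 0" and "i \<notin> A"
    and pays: "\<bar>q i * x i q - r * x i (q(i := r))\<bar> + r * \<bar>x i (q(i := r)) - w i\<bar>
      \<le> q i * (span3 (x i q) (m i) (w i) - alpha * lam * \<bar>w i - m i\<bar> * a i)"
  shows "jump_pot (insert i A) m a (q(i := r)) \<le> jump_pot A m a q"
proof -
  let ?q = "q(i := r)"
  define h where "h B p j = (if j \<in> B then \<bar>x j p - w j\<bar>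
      else span3 (x j p) (m j) (w j) - alpha * lam * \<bar>w j - m j\<bar> * a j)" for B p j
  have U: "UNIV = insert i (-{i})" by auto
  have split: "jump_pot B m a p = p i * h B p i + (\<Sum>j\<in>-{i}. p j * h B p j)" for B p
    unfolding jump_pot_def h_def[symmetric] by (subst U) simp
  have "?q j * h (insert i A) ?q j \<le> q j * h A q j + q j * \<bar>x j ?q - x j q\<bar>" if "j \<in> -{i}" for j
  proof -
    have "h (insert i A) ?q j \<le> h A q j + \<bar>x j ?q - x j q\<bar>"
      using that span3_lipschitz[of "x j ?q" "m j" "w j" "x j q"] by (auto simp: h_def)
    then have "q j * h (insert i A) ?q j \<le> q j * (h A q j + \<bar>x j ?q - x j q\<bar>)"
      using q by (intro mult_left_mono) (auto intro: less_imp_le)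
    then show ?thesis using that by (simp add: distrib_left)
  qed
  then have "(\<Sum>j\<in>-{i}. ?q j * h (insert i A) ?q j)
      \<le> (\<Sum>j\<in>-{i}. q j * h A q j + q j * \<bar>x j ?q - x j q\<bar>)"
    by (rule sum_mono)
  also have "\<dots> = (\<Sum>j\<in>-{i}. q j * h A q j) + \<bar>q i * x i q - r * x i ?q\<bar>"
    using spending_shift[OF q r] by (simp add: sum.distrib)
  finally show ?thesis unfolding split using pays \<open>i \<notin> A\<close> by (simp add: h_def)
qed

text \<open>Turns the response of demand into the elasticity hypotheses of the two numerical
  inequalities, one for rises and one for cuts.\<close>

lemma jump_pot_update:
  assumes q: "\<And>k. q k > 0" and "i \<notin> A" and a: "0 \<le> a i" "a i \<le> 1"
    and m: "0 \<le> m i" "m i \<le> d * w i"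
    and cut: "m i < w i \<Longrightarrow> x i q \<le> d * w i"
  shows "jump_pot (insert i A) m a (q(i := q i * (1 + lam * min 1 ((m i - w i) / w i)))) \<le> jump_pot A m a q"
proof -
  have X: "0 < x i q" using demand_pos q by blast
  note wi = w_pos[of i]
  show ?thesis
  proof (cases "w i \<le> m i")
    case True
    define r where "r = lam * min 1 ((m i - w i) / w i)"
    have r0: "0 \<le> r" using lam_pos True wi by (simp add: r_def)
    let ?q = "q(i := q i * (1 + r))"
    have np: "0 < q i * (1 + r)" using q r0 by simp
    have X': "0 < x i ?q" using demand_pos[of ?q] q np by auto
    note resp = own_price_response[of q "q i" "q i * (1 + r)" i, OF q q]
    have e: "q i * ((1 + r) * x i ?q) \<le> q i * x i q"
      using resp(2) q[of i] r0 by (simp add: algebra_simps)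
    then have e1: "(1 + r) * x i ?q \<le> x i q" using q[of i] by simp
    have "q i * (x i q * (1 - E * r)) \<le> q i * x i ?q"
      using resp(3) q[of i] r0 by (simp add: algebra_simps)
    then have e2: "x i q * (1 - E * r) \<le> x i ?q" using q[of i] by simp
    have "q i * (x i q - (1 + r) * x i ?q + (1 + r) * \<bar>x i ?q - w i\<bar>)
        \<le> q i * (span3 (x i q) (m i) (w i) - alpha * lam * \<bar>w i - m i\<bar> * a i)"
      using rise_pays[OF wi X X' True m(2) a r_def e1 e2] q[of i] by (intro mult_left_mono) auto
    moreover have "\<bar>q i * x i q - q i * (1 + r) * x i ?q\<bar> = q i * (x i q - (1 + r) * x i ?q)"
      using e by (simp add: algebra_simps)
    ultimately show ?thesis
      unfolding r_def[symmetric] by (intro jump_pot_step q np \<open>i \<notin> A\<close>) (simp add: algebra_simps)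
  next
    case False
    define r where "r = lam * ((w i - m i) / w i)"
    \<comment> \<open>The cap in the update rule never acts on a cut.\<close>
    have "(m i - w i) / w i \<le> 1" using False wi by simp
    then have min: "lam * min 1 ((m i - w i) / w i) = - r"
      by (simp add: r_def min_def minus_divide_left right_diff_distrib diff_divide_distrib)
    have r0: "0 \<le> r" using lam_pos False wi by (simp add: r_def)
    have "(w i - m i) / w i \<le> 1" using m wi by simp
    then have r1: "r \<le> lam" using mult_left_mono[of "(w i - m i) / w i" 1 lam] lam_pos unfolding r_def by simp
    then have r2: "r < 1" using bounds(2) by simp
    let ?q = "q(i := q i * (1 - r))"
    have np: "0 < q i * (1 - r)" using q r2 by simp
    have X': "0 < x i ?q" using demand_pos[of ?q] q np by auto
    have le: "q i * (1 - r) \<le> q i" using q[of i] r0 by simp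
    \<comment> \<open>For a cut the new price is the left endpoint, so the response bounds are
      relative to the new demand.\<close>
    note resp = own_price_response[of q "q i * (1 - r)" "q i" i, OF q np le]
    have e: "q i * x i q \<le> q i * ((1 - r) * x i ?q)"
      using resp(2) by (simp add: algebra_simps)
    then have e1: "x i q \<le> (1 - r) * x i ?q" using q[of i] by simp
    have "q i * ((1 - r - E * r) * x i ?q) \<le> q i * ((1 - r) * x i q)"
      using resp(3) by (simp add: algebra_simps)
    then have e3: "(1 - r - E * r) * x i ?q \<le> (1 - r) * x i q" using q[of i] by simp
    \<comment> \<open>The form needed by the cut inequality follows from
      \<open>(1 - r)^2 * (1 - E * r) \<le> 1 - r - E * r\<close>. The difference of the two sides is
      \<open>r * (1 - r * (1 + 2 * E) + E * r^2)\<close>, hence the bound on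
      \<open>lam * (1 + 2 * E)\<close>.\<close>
    have "r * (1 + 2 * E) \<le> lam * (1 + 2 * E)" using r1 E_ge by (intro mult_right_mono) auto
    then have "r * (1 + 2 * E) \<le> 1" using bounds(4) by simp
    moreover have "0 \<le> E * r * r" using E_ge r0 by simp
    ultimately have "0 \<le> r * (1 - r * (1 + 2 * E) + E * r * r)" using r0 by simp
    then have "(1 - r) * (1 - r) * (1 - E * r) \<le> 1 - r - E * r" by (simp add: algebra_simps)
    then have "(1 - r) * (1 - r) * (1 - E * r) * x i ?q \<le> (1 - r - E * r) * x i ?q"
      using X' by (intro mult_right_mono) auto
    then have "(1 - r) * ((1 - r) * x i ?q * (1 - E * r)) \<le> (1 - r) * x i q"
      using e3 by (simp add: algebra_simps)
    then have e2: "(1 - r) * x i ?q * (1 - E * r) \<le> x i q" using r2 by simp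
    have "q i * ((1 - r) * x i ?q - x i q + (1 - r) * \<bar>x i ?q - w i\<bar>)
        \<le> q i * (span3 (x i q) (m i) (w i) - alpha * lam * \<bar>w i - m i\<bar> * a i)"
      using cut_pays[OF wi X _ m(1) _ a r_def e1 e2] cut False q[of i] by (intro mult_left_mono) auto
    moreover have "\<bar>q i * x i q - q i * (1 - r) * x i ?q\<bar> = q i * ((1 - r) * x i ?q - x i q)"
      using e by (simp add: algebra_simps)
    ultimately have "jump_pot (insert i A) m a ?q \<le> jump_pot A m a q"
      by (intro jump_pot_step q np \<open>i \<notin> A\<close>) (simp add: algebra_simps)
    then show ?thesis unfolding min by simp
  qed
qed

text \<open>The price cuts come first: while some are carried out, the demand for the goods still waiting for
  a cut does not rise, and so stays below \<open>d * w\<close>. Price rises need no such bound.\<close>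

lemma jump_pot_simultaneous:
  assumes p: "\<And>k. p k > 0" and a: "\<And>i. i \<in> S \<Longrightarrow> 0 \<le> a i \<and> a i \<le> 1"
    and m: "\<And>i. i \<in> S \<Longrightarrow> 0 \<le> m i \<and> m i \<le> d * w i" and bounded: "\<And>i. x i p \<le> d * w i"
  shows "jump_pot S m a (\<lambda>i. if i \<in> S then p i * (1 + lam * min 1 ((m i - w i) / w i)) else p i)
         \<le> jump_pot {} m a p"
proof -
  define f where "f i = 1 + lam * min 1 ((m i - w i) / w i)" for i
  define q where "q A i = (if i \<in> A then p i * f i else p i)" for A i
  define C where "C = {i \<in> S. m i < w i}"
  have f_pos: "f i > 0" if "i \<in> S" for i
  proof -
    have "0 \<le> m i / w i" using m[OF that] w_pos[of i] by simp
    then have "-1 \<le> min 1 ((m i - w i) / w i)" using w_pos[of i] by (simp add: diff_divide_distrib)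
    then have "lam * (-1) \<le> lam * min 1 ((m i - w i) / w i)" using lam_pos by (intro mult_left_mono) auto
    then show ?thesis using bounds(2) by (simp add: f_def)
  qed
  have q_pos: "q A k > 0" if "A \<subseteq> S" for A k
    using that p[of k] f_pos[of k] by (auto simp: q_def)
  have f_le: "f i \<le> 1" if "i \<in> C" for i
  proof -
    have "(m i - w i) / w i \<le> 0" using that w_pos[of i] by (simp add: C_def divide_le_0_iff)
    then have "min 1 ((m i - w i) / w i) \<le> 0" by simp
    then have "lam * min 1 ((m i - w i) / w i) \<le> 0" using lam_pos mult_nonneg_nonpos less_imp_le by blast
    then show ?thesis by (simp add: f_def)
  qed
  have q_insert: "q (insert i A) = (q A)(i := q A i * f i)" if "i \<notin> A" for i A
    using that by (auto simp: q_def)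
  have step: "jump_pot (insert i A) m a (q (insert i A)) \<le> jump_pot A m a (q A)"
    if "i \<notin> A" "insert i A \<subseteq> S" "i \<in> C \<longrightarrow> x i (q A) \<le> d * w i" for i A
    using jump_pot_update[of "q A" i A a m] q_pos[of A] that a[of i] m[of i]
    unfolding q_insert[OF that(1)] by (auto simp: C_def f_def)
  \<comment> \<open>The second conjunct keeps the demand bound alive for goods still to be cut: by
    gross substitutes, cutting other prices cannot raise their demand.\<close>
  have "jump_pot A m a (q A) \<le> jump_pot {} m a (q {}) \<and> (\<forall>j\<in>-A. x j (q A) \<le> x j p)"
    if "finite A" "A \<subseteq> C" for A
    using that
  proof (induction A rule: finite_induct)
    case empty
    then show ?case by (simp add: q_def)
  next
    case (insert i A)
    then have IH: "jump_pot A m a (q A) \<le> jump_pot {} m a (q {})" "\<forall>j\<in>-A. x j (q A) \<le> x j p"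
      and i: "i \<in> C" "insert i A \<subseteq> S" by (auto simp: C_def)
    have "x i (q A) \<le> d * w i" using IH(2) insert.hyps(2) bounded[of i] by force
    then have "jump_pot (insert i A) m a (q (insert i A)) \<le> jump_pot A m a (q A)"
      using step insert.hyps(2) i by blast
    moreover have "x j (q (insert i A)) \<le> x j p" if "j \<in> - insert i A" for j
    proof -
      have pos: "q A k > 0" for k using q_pos[of A] i by auto
      have "q A i * f i \<le> q A i" "0 < q A i * f i"
        using f_le[OF i(1)] f_pos[of i] i pos[of i] by (auto simp: mult_left_le)
      then have "x j ((q A)(i := q A i * f i)) \<le> x j ((q A)(i := q A i))"
        using that pos by (intro WGS) auto
      then have "x j (q (insert i A)) \<le> x j (q A)" using q_insert insert.hyps(2) by simp
      then show ?thesis using IH(2) that by force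
    qed
    ultimately show ?case using IH(1) by auto
  qed
  then have cuts: "jump_pot C m a (q C) \<le> jump_pot {} m a (q {})" by simp
  have "jump_pot (C \<union> A) m a (q (C \<union> A)) \<le> jump_pot C m a (q C)"
    if "finite A" "A \<subseteq> S - C" for A
    using that
  proof (induction A rule: finite_induct)
    case (insert i A)
    then have "jump_pot (insert i (C \<union> A)) m a (q (insert i (C \<union> A))) \<le> jump_pot (C \<union> A) m a (q (C \<union> A))"
      by (intro step) (auto simp: C_def)
    then show ?case using insert by simp
  qed simp
  from this[of "S - C"] have "jump_pot S m a (q S) \<le> jump_pot C m a (q C)"
    by (simp add: C_def Un_absorb1)
  moreover have "q {} = p" "q S = (\<lambda>i. if i \<in> S then p i * (1 + lam * min 1 ((m i - w i) / w i)) else p i)"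
    by (auto simp: q_def f_def)
  ultimately show ?thesis using cuts by simp
qed

end

section \<open>Update times and resting prices\<close>

locale price_process = elastic_market w x lam alpha M E d
  for w :: "'g::finite \<Rightarrow> real" and x lam alpha M E d +
  fixes P :: "real \<Rightarrow> 'g \<Rightarrow> real" and U :: "'g \<Rightarrow> real set"
  assumes upd_nonneg: "U i \<subseteq> {0..}"
    and upd_zero: "0 \<in> U i"
    and upd_finite: "finite (U i \<inter> {..T})"
    and upd_gap: "t \<ge> 0 \<Longrightarrow> \<exists>u\<in>U i. t < u \<and> u \<le> t + 1"
    and P0_pos: "P 0 i > 0"
    and P_const: "t \<ge> 0 \<Longrightarrow> P t i = P (last_upd U i t) i"
    and P_update: "t \<in> U i \<Longrightarrow> t > 0 \<Longrightarrow>
          P t i = P (prev_upd U i t) i *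
            (1 + lam * min 1 ((avg_dem x P i (prev_upd U i t) t - w i) / w i))"
    and demand_bound: "t \<ge> 0 \<Longrightarrow> x i (P t) \<le> d * w i"
begin

text \<open>The update times of all goods pooled: prices rest between consecutive points.\<close>

definition V :: "real set" where "V = (\<Union>i. U i)"

lemma finite_V: "finite (V \<inter> {a<..<b})"
proof -
  have "V \<inter> {a<..<b} \<subseteq> (\<Union>i. U i \<inter> {..b})" by (auto simp: V_def)
  then show ?thesis using upd_finite by (meson finite_UN finite_class.finite_UNIV finite_subset)
qed

lemma last_upd_props:
  assumes "0 \<le> t"
  shows "last_upd U i t \<in> U i" "0 \<le> last_upd U i t" "last_upd U i t \<le> t"
    "\<And>s. s \<in> U i \<Longrightarrow> s \<le> t \<Longrightarrow> s \<le> last_upd U i t"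
proof -
  have f: "finite (U i \<inter> {0..t})" by (rule finite_subset[OF _ upd_finite[of i t]]) auto
  have "0 \<in> U i \<inter> {0..t}" using upd_zero assms by auto
  then have "last_upd U i t \<in> U i \<inter> {0..t}" unfolding last_upd_def using f by (intro Max_in) auto
  then show "last_upd U i t \<in> U i" "0 \<le> last_upd U i t" "last_upd U i t \<le> t" by auto
  show "s \<le> last_upd U i t" if "s \<in> U i" "s \<le> t" for s
    unfolding last_upd_def using f that upd_nonneg[of i] by (intro Max_ge) auto
qed

lemma last_upd_eqI:
  assumes "0 \<le> t" "r \<in> U i" "r \<le> t" "\<And>s. s \<in> U i \<Longrightarrow> s \<le> t \<Longrightarrow> s \<le> r"
  shows "last_upd U i t = r"
proof (rule antisym)
  show "last_upd U i t \<le> r" by (rule assms(4)) (rule last_upd_props[OF assms(1)])+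
  show "r \<le> last_upd U i t" by (rule last_upd_props(4)[OF assms(1-3)])
qed

lemma last_upd_recent:
  assumes "0 \<le> t"
  shows "t \<le> last_upd U i t + 1"
proof -
  note props = last_upd_props[OF assms, where i = i]
  obtain u where u: "u \<in> U i" "last_upd U i t < u" "u \<le> last_upd U i t + 1"
    using upd_gap props(2) by blast
  then have "t < u" using props(4)[OF u(1)] by linarith
  then show ?thesis using u(3) by simp
qed

text \<open>The next update of good \<open>i\<close> lies after \<open>a\<close> but not strictly
  before \<open>b\<close>. Hence the averaging period is at most a day even at \<open>b\<close>,
  where the good may be updated.\<close>

lemma last_upd_recent_rest:
  assumes "0 \<le> a" "V \<inter> {a<..<b} = {}"
  shows "b \<le> last_upd U i a + 1"
proof -
  note props = last_upd_props[OF assms(1), where i = i]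
  obtain u where u: "u \<in> U i" "last_upd U i a < u" "u \<le> last_upd U i a + 1"
    using upd_gap props(2) by blast
  have "u \<in> V" using u by (auto simp: V_def)
  then have "u \<notin> {a<..<b}" using assms(2) by blast
  moreover have "a < u" using props(4)[OF u(1)] u(2) by linarith
  ultimately show ?thesis using u(3) by auto
qed

lemma last_upd_rest:
  assumes "0 \<le> a" "V \<inter> {a<..<b} = {}" "a \<le> s" "s < b"
  shows "last_upd U i s = last_upd U i a"
proof (rule last_upd_eqI)
  show "r \<le> last_upd U i a" if "r \<in> U i" "r \<le> s" for r
  proof -
    have "r \<in> V" using that by (auto simp: V_def)
    then have "r \<notin> {a<..<b}" using assms(2) by blast
    then have "r \<le> a" using that assms by auto
    then show ?thesis using last_upd_props(4)[OF assms(1)] that by blast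
  qed
qed (use last_upd_props[OF assms(1), where i = i] assms in auto)

lemma last_upd_at_rest:
  assumes "0 \<le> a" "a < b" "V \<inter> {a<..<b} = {}" "b \<notin> U i"
  shows "last_upd U i b = last_upd U i a"
proof (rule last_upd_eqI)
  show "r \<le> last_upd U i a" if "r \<in> U i" "r \<le> b" for r
  proof -
    have "r \<in> V" using that by (auto simp: V_def)
    then have "r \<notin> {a<..<b}" using assms(3) by blast
    moreover have "r \<noteq> b" using that assms(4) by blast
    ultimately have "r \<le> a" using that by auto
    then show ?thesis using last_upd_props(4)[OF assms(1)] that by blast
  qed
qed (use last_upd_props[OF assms(1), where i = i] assms in auto)

lemma prev_upd_rest:
  assumes "0 \<le> a" "a < b" "V \<inter> {a<..<b} = {}"
  shows "prev_upd U i b = last_upd U i a"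
proof -
  have "r \<le> a" if "r \<in> U i" "r < b" for r
  proof -
    have "r \<in> V" using that by (auto simp: V_def)
    then have "r \<notin> {a<..<b}" using assms(3) by blast
    then show "r \<le> a" using that by auto
  qed
  then have "U i \<inter> {0..<b} = U i \<inter> {0..a}" using assms by auto
  then show ?thesis by (simp add: prev_upd_def last_upd_def)
qed

lemma P_rest:
  assumes "0 \<le> a" "V \<inter> {a<..<b} = {}" "a \<le> s" "s < b"
  shows "P s = P a"
proof
  fix i show "P s i = P a i"
    using P_const[of s i] P_const[of a i] last_upd_rest[OF assms] assms by simp
qed

lemma demand_has_integral_rest:
  assumes "0 \<le> a" "a \<le> b" "V \<inter> {a<..<b} = {}"
  shows "((\<lambda>s. x i (P s)) has_integral (b - a) * x i (P a)) {a..b}"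
\<comment> \<open>Prices may jump at \<open>b\<close> itself, but a single point does not affect the
  integral.\<close>
proof (rule has_integral_spike[of "{b}"])
  show "((\<lambda>_. x i (P a)) has_integral (b - a) * x i (P a)) {a..b}"
    using has_integral_const_real[of "x i (P a)" a b] assms by simp
  show "x i (P s) = x i (P a)" if "s \<in> {a..b} - {b}" for s
    using P_rest[OF assms(1,3), of s] that by auto
qed simp

section \<open>Integrability and positivity along the trajectory\<close>

lemma demand_integrable:
  assumes "0 \<le> a" "a \<le> b"
  shows "(\<lambda>s. x i (P s)) integrable_on {a..b}"
proof (cases "a = b")
  case False
  then have "a < b" using assms by simp
  from finite_V _ _ assms(1) this show ?thesis
  proof (rule interval_chain_induct)
    show "(\<lambda>s. x i (P s)) integrable_on {a..b}" if "0 \<le> a" "a < b" "V \<inter> {a<..<b} = {}" for a b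
      using demand_has_integral_rest[of a b i] that by auto
    show "(\<lambda>s. x i (P s)) integrable_on {a..c}"
      if "0 \<le> a" "a < b" "b < c" "(\<lambda>s. x i (P s)) integrable_on {a..b}"
        "(\<lambda>s. x i (P s)) integrable_on {b..c}" for a b c
      using Henstock_Kurzweil_Integration.integrable_combine[of a b c] that by auto
  qed
qed (use demand_has_integral_rest[of b b i] assms in auto)

text \<open>An update keeps a price positive only if the preceding average is nonnegative, which
  needs positivity of all earlier prices. So positivity on the whole past is propagated, as an
  implication that composes over adjacent intervals.\<close>

lemma P_pos:
  assumes "0 \<le> t"
  shows "P t i > 0"
proof (cases "t = 0")
  case False
  have "(\<forall>s\<in>{0..0}. \<forall>j. P s j > 0) \<longrightarrow> (\<forall>s\<in>{0..t}. \<forall>j. P s j > 0)"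
  proof (rule interval_chain_induct[OF finite_V _ _ order.refl,
        where Q = "\<lambda>a b. (\<forall>s\<in>{0..a}. \<forall>j. P s j > 0) \<longrightarrow> (\<forall>s\<in>{0..b}. \<forall>j. P s j > 0)"])
    fix a b :: real
    assume ab: "0 \<le> a" "a < b" "V \<inter> {a<..<b} = {}"
    show "(\<forall>s\<in>{0..a}. \<forall>j. P s j > 0) \<longrightarrow> (\<forall>s\<in>{0..b}. \<forall>j. P s j > 0)"
    proof
      assume IH: "\<forall>s\<in>{0..a}. \<forall>j. P s j > 0"
      have before: "P s j > 0" if "0 \<le> s" "s < b" for s j
        using that IH P_rest[OF ab(1,3), of s] ab(1) by (cases "s \<le> a") auto
      have "P b j > 0" for j
      proof (cases "b \<in> U j")
        case True
        define r where "r = last_upd U j a"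
        have r: "0 \<le> r" "r < b" using last_upd_props[OF ab(1), where i = j] ab by (auto simp: r_def)
        have "0 \<le> integral {r..b} (\<lambda>s. x j (P s))"
        proof -
          have "((\<lambda>s. x j (P s)) has_integral integral {r..b} (\<lambda>s. x j (P s))) {r..b}"
            using demand_integrable[of r b j] r by (simp add: integrable_integral)
          \<comment> \<open>The prices at \<open>b\<close> are not yet known to be positive, so the
            integrand is reset to 0 there.\<close>
          then have h: "((\<lambda>s. if s = b then 0 else x j (P s)) has_integral integral {r..b} (\<lambda>s. x j (P s))) {r..b}"
            by (rule has_integral_spike[of "{b}", rotated 2]) auto
          show ?thesis
            by (rule has_integral_nonneg[OF h])
              (use before r demand_pos in \<open>force intro: less_imp_le\<close>)
        qed
        then have "0 \<le> avg_dem x P j r b" using r by (simp add: avg_dem_def)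
        then have "- 1 \<le> (avg_dem x P j r b - w j) / w j"
          using w_pos[of j] by (simp add: le_divide_eq)
        then have "lam * (- 1) \<le> lam * min 1 ((avg_dem x P j r b - w j) / w j)"
          using lam_pos by (intro mult_left_mono) auto
        then have "0 < 1 + lam * min 1 ((avg_dem x P j r b - w j) / w j)" using bounds(2) by simp
        then show ?thesis
          using P_update[OF True] prev_upd_rest[OF ab, of j] before[of r j] r ab by (simp add: r_def)
      next
        case False
        define r where "r = last_upd U j b"
        have r: "0 \<le> r" "r \<le> b" "r \<in> U j" using last_upd_props[of b, where i = j] ab by (auto simp: r_def)
        then have "r < b" using False by (cases "r = b") auto
        then show ?thesis using P_const[of b j] before[of r j] r ab by (simp add: r_def)
      qed
      then show "\<forall>s\<in>{0..b}. \<forall>j. P s j > 0"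
        using before by (metis atLeastAtMost_iff linorder_not_less order_antisym)
    qed
  next
    show "0 < t" using assms False by simp
  qed blast+
  then show ?thesis using P0_pos assms by auto
qed (use P0_pos in simp)

lemma avg_dem_bounds:
  assumes "0 \<le> r" "r < t"
  shows "0 \<le> avg_dem x P i r t" "avg_dem x P i r t \<le> d * w i"
proof -
  have int: "(\<lambda>s. x i (P s)) integrable_on {r..t}" using demand_integrable assms by simp
  have "0 \<le> x i (P s)" if "s \<in> {r..t}" for s
    using demand_pos[of "P s" i] P_pos[of s] that assms by (auto intro: less_imp_le)
  then show "0 \<le> avg_dem x P i r t"
    using integral_nonneg[OF int] assms by (simp add: avg_dem_def)
  have "integral {r..t} (\<lambda>s. x i (P s)) \<le> integral {r..t} (\<lambda>_. d * w i)"
    using demand_bound assms by (intro integral_le int) auto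
  then show "avg_dem x P i r t \<le> d * w i"
    using assms by (simp add: avg_dem_def divide_le_eq algebra_simps)
qed

section \<open>Decay of the potential in time\<close>

text \<open>The correction is at most half the distance from average to supply, and the span
  dominates that distance. Nonnegativity later allows decay factors to be replaced by larger
  ones.\<close>

lemma phi_nonneg:
  assumes t: "0 \<le> t"
  shows "0 \<le> phi alpha lam w x P U t"
  unfolding phi_def
proof (rule sum_nonneg)
  fix i
  define e where "e = \<bar>w i - xbar x P U i t\<bar>"
  have "lam * alpha * (t - last_upd U i t) \<le> 1/2 * 1"
    using bounds(3) last_upd_recent[OF t, of i] last_upd_props(3)[OF t, of i] by (intro mult_mono) auto
  then have "lam * alpha * (t - last_upd U i t) * e \<le> 1 * e"
    by (intro mult_right_mono) (auto simp: e_def)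
  also have "1 * e \<le> span3 (x i (P t)) (xbar x P U i t) (w i)"
    using span3_ge(3)[of "xbar x P U i t" "w i" "x i (P t)"] by (simp add: e_def abs_minus_commute)
  finally show "0 \<le> phi_i alpha lam w x P U i t"
    using P_pos[OF t, of i] unfolding phi_i_def e_def by (intro mult_nonneg_nonneg) (auto simp: algebra_simps)
qed

text \<open>The left side is the left limit of \<open>phi\<close> at \<open>u\<close>: the prices
  are still those at \<open>v\<close>, while the averages already extend to
  \<open>u\<close>.\<close>

lemma flow_phi:
  assumes vu: "0 \<le> v" "v < u" "V \<inter> {v<..<u} = {}"
  shows "jump_pot {} (\<lambda>i. avg_dem x P i (last_upd U i v) u) (\<lambda>i. u - last_upd U i v) (P v)
         \<le> (1 - lam * alpha * (u - v)) * phi alpha lam w x P U v"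
  unfolding phi_def jump_pot_def sum_distrib_left
proof (rule sum_mono)
  fix i
  define r where "r = last_upd U i v"
  have r: "0 \<le> r" "r \<le> v" using last_upd_props[OF vu(1), where i = i] by (auto simp: r_def)
  \<comment> \<open>If good \<open>i\<close> was updated at \<open>v\<close> itself, both sides
    vanish, whatever value \<open>xbar\<close> takes there.\<close>
  have past: "integral {r..v} (\<lambda>s. x i (P s)) = (v - r) * xbar x P U i v"
    using r by (auto simp: xbar_def avg_dem_def r_def[symmetric])
  have "integral {v..u} (\<lambda>s. x i (P s)) = (u - v) * x i (P v)"
    using demand_has_integral_rest[of v u i] vu by (simp add: integral_unique)
  then have "integral {r..u} (\<lambda>s. x i (P s)) = (v - r) * xbar x P U i v + (u - v) * x i (P v)"
    using Henstock_Kurzweil_Integration.integral_combine[OF r(2) _ demand_integrable, of u i] vu r past by simp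
  then have avg: "avg_dem x P i r u
      = ((v - r) * xbar x P U i v + (u - v) * x i (P v)) / ((v - r) + (u - v))"
    by (simp add: avg_dem_def)
  have "span3 (x i (P v)) (avg_dem x P i r u) (w i)
        - lam * alpha * \<bar>w i - avg_dem x P i r u\<bar> * ((v - r) + (u - v))
      \<le> (1 - lam * alpha * (u - v)) * (span3 (x i (P v)) (xbar x P U i v) (w i)
        - lam * alpha * \<bar>w i - xbar x P U i v\<bar> * (v - r))"
    unfolding avg
    using r vu last_upd_recent_rest[OF vu(1,3), of i] lam_pos alpha_pos bounds(3)
    by (intro flow_decrease) (auto simp: r_def)
  then have "P v i * (span3 (x i (P v)) (avg_dem x P i r u) (w i)
        - lam * alpha * \<bar>w i - avg_dem x P i r u\<bar> * ((v - r) + (u - v)))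
      \<le> P v i * ((1 - lam * alpha * (u - v)) * (span3 (x i (P v)) (xbar x P U i v) (w i)
        - lam * alpha * \<bar>w i - xbar x P U i v\<bar> * (v - r)))"
    using P_pos[OF vu(1), of i] by (intro mult_left_mono) auto
  then show "P v i * (if i \<in> {} then \<bar>x i (P v) - w i\<bar>
        else span3 (x i (P v)) (avg_dem x P i (last_upd U i v) u) (w i)
          - alpha * lam * \<bar>w i - avg_dem x P i (last_upd U i v) u\<bar> * (u - last_upd U i v))
      \<le> (1 - lam * alpha * (u - v)) * phi_i alpha lam w x P U i v"
    unfolding phi_i_def r_def by (simp add: mult.commute[of alpha lam] mult.left_commute)
qed

text \<open>A good updated at \<open>u\<close> restarts its averaging period: its average equals its
  current demand and its correction vanishes, which is the updated branch of
  \<open>jump_pot\<close>.\<close>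

lemma phi_after_update:
  assumes vu: "0 \<le> v" "v < u" "V \<inter> {v<..<u} = {}"
  shows "phi alpha lam w x P U u = jump_pot {i. u \<in> U i}
      (\<lambda>i. avg_dem x P i (last_upd U i v) u) (\<lambda>i. u - last_upd U i v) (P u)"
  unfolding phi_def jump_pot_def
proof (rule sum.cong[OF refl])
  fix i
  show "phi_i alpha lam w x P U i u = P u i * (if i \<in> {i. u \<in> U i} then \<bar>x i (P u) - w i\<bar>
      else span3 (x i (P u)) (avg_dem x P i (last_upd U i v) u) (w i)
        - alpha * lam * \<bar>w i - avg_dem x P i (last_upd U i v) u\<bar> * (u - last_upd U i v))"
  proof (cases "u \<in> U i")
    case True
    then have "last_upd U i u = u" using vu by (intro last_upd_eqI) auto
    then show ?thesis using True by (simp add: phi_i_def xbar_def span3_same)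
  next
    case False
    have "last_upd U i u = last_upd U i v" by (rule last_upd_at_rest[OF vu False])
    then show ?thesis
      using False last_upd_props(3)[OF vu(1), of i] vu by (simp add: phi_i_def xbar_def)
  qed
qed

lemma P_after_update:
  assumes vu: "0 \<le> v" "v < u" "V \<inter> {v<..<u} = {}"
  shows "P u = (\<lambda>i. if i \<in> {i. u \<in> U i}
    then P v i * (1 + lam * min 1 ((avg_dem x P i (last_upd U i v) u - w i) / w i)) else P v i)"
proof
  fix i
  have "P v i = P (last_upd U i v) i" using P_const vu by simp
  then show "P u i = (if i \<in> {i. u \<in> U i}
      then P v i * (1 + lam * min 1 ((avg_dem x P i (last_upd U i v) u - w i) / w i)) else P v i)"
    using P_update[of u i] prev_upd_rest[OF vu, of i] P_const[of u i] last_upd_at_rest[OF vu, of i] vu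
    by auto
qed

lemma phi_rest_step:
  assumes vu: "0 \<le> v" "v < u" "V \<inter> {v<..<u} = {}"
  shows "phi alpha lam w x P U u \<le> (1 - lam * alpha * (u - v)) * phi alpha lam w x P U v"
proof -
  let ?m = "\<lambda>i. avg_dem x P i (last_upd U i v) u" and ?a = "\<lambda>i. u - last_upd U i v"
  have "jump_pot {i. u \<in> U i} ?m ?a (P u) \<le> jump_pot {} ?m ?a (P v)"
    unfolding P_after_update[OF vu]
  proof (rule jump_pot_simultaneous)
    fix i
    have r: "0 \<le> last_upd U i v" "last_upd U i v < u"
      using last_upd_props[OF vu(1), where i = i] vu by auto
    show "0 \<le> ?a i \<and> ?a i \<le> 1" using last_upd_recent_rest[OF vu(1,3), of i] r by auto
    show "0 \<le> ?m i \<and> ?m i \<le> d * w i" using avg_dem_bounds[OF r] by blast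
  qed (use P_pos demand_bound vu in auto)
  then show ?thesis using flow_phi[OF vu] phi_after_update[OF vu] by linarith
qed

text \<open>The linear factor of each resting stretch is weakened to an exponential, because
  exponentials multiply exactly when stretches are joined.\<close>

lemma phi_decay:
  assumes "0 \<le> s" "s \<le> t"
  shows "phi alpha lam w x P U t \<le> exp (- (lam * alpha * (t - s))) * phi alpha lam w x P U s"
proof (cases "s = t")
  case False
  then have "s < t" using assms by simp
  show ?thesis
  proof (rule interval_chain_induct[OF finite_V _ _ assms(1) \<open>s < t\<close>,
        where Q = "\<lambda>s t. phi alpha lam w x P U t \<le> exp (- (lam * alpha * (t - s))) * phi alpha lam w x P U s"])
    fix v u :: real
    assume vu: "0 \<le> v" "v < u" "V \<inter> {v<..<u} = {}"
    have "1 - lam * alpha * (u - v) \<le> exp (- (lam * alpha * (u - v)))"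
      using exp_ge_add_one_self[of "- (lam * alpha * (u - v))"] by simp
    then have "(1 - lam * alpha * (u - v)) * phi alpha lam w x P U v
        \<le> exp (- (lam * alpha * (u - v))) * phi alpha lam w x P U v"
      using phi_nonneg[OF vu(1)] by (rule mult_right_mono)
    then show "phi alpha lam w x P U u \<le> exp (- (lam * alpha * (u - v))) * phi alpha lam w x P U v"
      using phi_rest_step[OF vu] by linarith
  next
    fix a b c :: real
    assume ab: "phi alpha lam w x P U b \<le> exp (- (lam * alpha * (b - a))) * phi alpha lam w x P U a"
      and bc: "phi alpha lam w x P U c \<le> exp (- (lam * alpha * (c - b))) * phi alpha lam w x P U b"
    have "exp (- (lam * alpha * (c - b))) * phi alpha lam w x P U b
        \<le> exp (- (lam * alpha * (c - b))) * (exp (- (lam * alpha * (b - a))) * phi alpha lam w x P U a)"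
      using ab by (intro mult_left_mono) auto
    also have "\<dots> = exp (- (lam * alpha * (c - a))) * phi alpha lam w x P U a"
    proof -
      have "- (lam * alpha * (c - a)) = - (lam * alpha * (c - b)) + - (lam * alpha * (b - a))"
        by (simp add: algebra_simps)
      then show ?thesis by (simp only: exp_add mult.assoc)
    qed
    finally show "phi alpha lam w x P U c \<le> exp (- (lam * alpha * (c - a))) * phi alpha lam w x P U a"
      by (rule order_trans[OF bc])
  qed
qed simp

lemma phi_daily_decay:
  assumes t: "0 \<le> t"
  shows "phi alpha lam w x P U (t + 1) \<le> (1 - lam * alpha / 2) * phi alpha lam w x P U t"
proof -
  let ?c = "lam * alpha"
  have c: "0 < ?c" "?c \<le> 1" using lam_pos alpha_pos bounds(3) by auto
  have "?c * ?c \<le> 1 * ?c" using c by (intro mult_right_mono) auto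
  \<comment> \<open>The product is \<open>1 + ?c / 2 - ?c * ?c / 2\<close>, at least 1 because
    \<open>?c \<le> 1\<close>; so the exponential is bounded through
    \<open>1 / (1 + ?c)\<close>.\<close>
  then have "1 \<le> (1 - ?c / 2) * (1 + ?c)" by (simp add: algebra_simps)
  then have frac: "1 / (1 + ?c) \<le> 1 - ?c / 2" using c by (simp add: divide_le_eq)
  have "exp (- ?c) \<le> 1 / (1 + ?c)"
    using exp_ge_add_one_self[of ?c] c by (simp add: exp_minus field_simps)
  also note frac
  finally have "exp (- ?c) * phi alpha lam w x P U t \<le> (1 - ?c / 2) * phi alpha lam w x P U t"
    using phi_nonneg[OF t] by (intro mult_right_mono) auto
  then show ?thesis using phi_decay[of t "t + 1"] t by simp
qed

lemma phi_reaches: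
  assumes t: "0 \<le> t" and F: "0 < F"
  shows "phi alpha lam w x P U
      (t + real (nat \<lceil>2 / (lam * alpha) * ln (phi alpha lam w x P U t / F)\<rceil>)) \<le> F"
proof -
  let ?c = "lam * alpha" and ?p = "phi alpha lam w x P U t"
  define n where "n = nat \<lceil>2 / ?c * ln (?p / F)\<rceil>"
  have c: "0 < ?c" using lam_pos alpha_pos by simp
  have "phi alpha lam w x P U (t + real n) \<le> exp (- (?c * real n)) * ?p"
    using phi_decay[of t "t + real n"] t by simp
  also have "\<dots> \<le> F"
  \<comment> \<open>If the target is already met, only monotonicity matters; this also covers
    \<open>?p = 0\<close>, where \<open>ln\<close> takes its default value.\<close>
  proof (cases "?p \<le> F")
    case True
    have "exp (- (?c * real n)) * ?p \<le> 1 * ?p"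
      using c phi_nonneg[OF t] by (intro mult_right_mono) auto
    then show ?thesis using True by simp
  next
    case False
    then have p: "0 < ?p" "0 < ln (?p / F)" using F by auto
    have "2 / ?c * ln (?p / F) \<le> real n" unfolding n_def by (rule real_nat_ceiling_ge)
    then have "2 * ln (?p / F) \<le> ?c * real n" using c by (simp add: field_simps)
    then have "exp (- (?c * real n)) \<le> exp (- ln (?p / F))" using p by simp
    also have "\<dots> = F / ?p" using p F by (simp add: exp_minus)
    finally show ?thesis using p by (simp add: le_divide_eq)
  qed
  finally show ?thesis by (simp add: n_def)
qed

end

theorem mainTheorem10:
  fixes w :: "'g::finite \<Rightarrow> real"
    and x :: "'g \<Rightarrow> ('g \<Rightarrow> real) \<Rightarrow> real"
    and P :: "real \<Rightarrow> 'g \<Rightarrow> real"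
    and U :: "'g \<Rightarrow> real set"
    and lam alpha1 M E d :: real
  assumes w_pos: "\<forall>i. w i > 0"
    and lam_pos: "lam > 0" and alpha_pos: "alpha1 > 0" and M_pos: "M > 0"
    and demand_pos: "\<forall>i p. (\<forall>j. p j > 0) \<longrightarrow> x i p > 0"
    and spending: "\<forall>p. (\<forall>j. p j > 0) \<longrightarrow> (\<Sum>i\<in>UNIV. p i * x i p) = M"
    and WGS: "\<forall>i j p a b. j \<noteq> i \<longrightarrow> (\<forall>k. p k > 0) \<longrightarrow> 0 < a \<longrightarrow> a \<le> b
                 \<longrightarrow> x j (p(i := a)) \<le> x j (p(i := b))"
    and E_ge: "E \<ge> 1"
    and elasticity: "\<forall>i p. (\<forall>k. p k > 0) \<longrightarrow>
                 (\<exists>D. ((\<lambda>q. x i (p(i := q))) has_real_derivative D) (at (p i))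
                      \<and> x i p / p i \<le> - D \<and> - D \<le> E * (x i p / p i))"
    and upd_nonneg: "\<forall>i. U i \<subseteq> {0..}"
    and upd_zero: "\<forall>i. 0 \<in> U i"
    and upd_finite: "\<forall>i T. finite (U i \<inter> {..T})"
    and upd_gap: "\<forall>i t. t \<ge> 0 \<longrightarrow> (\<exists>u\<in>U i. t < u \<and> u \<le> t + 1)"
    and P0_pos: "\<forall>i. P 0 i > 0"
    and P_const: "\<forall>i t. t \<ge> 0 \<longrightarrow> P t i = P (last_upd U i t) i"
    and P_update: "\<forall>i t. t \<in> U i \<longrightarrow> t > 0 \<longrightarrow>
                 P t i = P (prev_upd U i t) i *
                   (1 + lam * min 1 ((avg_dem x P i (prev_upd U i t) t - w i) / w i))"
    and demand_bound: "\<forall>i t. t \<ge> 0 \<longrightarrow> x i (P t) \<le> d * w i"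
    and d_ge: "d \<ge> 2"
    and alpha_d: "alpha1 * (d - 1) \<le> 1"
    and lamE: "lam * E < 1"
    and lam_cond: "lam * alpha1 + lam * (1 + 2 * E * d / (1 - lam * E)) \<le> 1"
  shows "(\<forall>t\<ge>0. phi alpha1 lam w x P U (t + 1) \<le> (1 - lam * alpha1 / 2) * phi alpha1 lam w x P U t)
       \<and> (\<forall>t\<ge>0. \<forall>phiF>0.
            phi alpha1 lam w x P U
              (t + real (nat \<lceil>2 / (lam * alpha1) * ln (phi alpha1 lam w x P U t / phiF)\<rceil>)) \<le> phiF)"
proof -
  interpret price_process w x lam alpha1 M E d P U
  proof unfold_locales
    fix i j p a b t T
    show "w i > 0" by (rule w_pos[rule_format])
    show "x i p > 0" if "\<And>k. p k > 0" by (rule demand_pos[rule_format]) (rule that)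
    show "(\<Sum>i\<in>UNIV. p i * x i p) = M" if "\<And>k. p k > 0" by (rule spending[rule_format]) (rule that)
    show "x j (p(i := a)) \<le> x j (p(i := b))" if "j \<noteq> i" "\<And>k. p k > 0" "0 < a" "a \<le> b"
      by (rule WGS[rule_format]) (rule that)+
    show "\<exists>D. ((\<lambda>q. x i (p(i := q))) has_real_derivative D) (at (p i))
        \<and> x i p / p i \<le> - D \<and> - D \<le> E * (x i p / p i)" if "\<And>k. p k > 0"
      by (rule elasticity[rule_format]) (rule that)
    show "U i \<subseteq> {0..}" by (rule upd_nonneg[rule_format])
    show "0 \<in> U i" by (rule upd_zero[rule_format])
    show "finite (U i \<inter> {..T})" by (rule upd_finite[rule_format])
    show "\<exists>u\<in>U i. t < u \<and> u \<le> t + 1" if "t \<ge> 0" by (rule upd_gap[rule_format]) (rule that)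
    show "P 0 i > 0" by (rule P0_pos[rule_format])
    show "P t i = P (last_upd U i t) i" if "t \<ge> 0" by (rule P_const[rule_format]) (rule that)
    show "P t i = P (prev_upd U i t) i *
        (1 + lam * min 1 ((avg_dem x P i (prev_upd U i t) t - w i) / w i))" if "t \<in> U i" "t > 0"
      by (rule P_update[rule_format]) (rule that)+
    show "x i (P t) \<le> d * w i" if "t \<ge> 0" by (rule demand_bound[rule_format]) (rule that)
  qed (rule lam_pos alpha_pos E_ge d_ge alpha_d lamE lam_cond)+
  show ?thesis by (intro conjI allI impI phi_daily_decay phi_reaches)
qed

end
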